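(* Let $X\in\mathbb{R}^{n\times p}$ be a centered data matrix with columns $X_1,\dots,X_p$, and let $a,k$ be positive integers with $a\le n$, $k\le p$. Consider the problem $$(P)\qquad \max_{s\in\{0,1\}^p,\;U\in\mathbb{R}^{n\times a}}\ \sum_{i=1}^p s_i\sum_{j=1}^a (X_i^TU_j)^2\quad\text{s.t.}\quad \sum_{i=1}^p s_i\le k,\ \ U^TU=I_a .$$ There exist $\delta_0>0$ and $\bar\eta\ge0$ such that the following holds whenever Algorithm 2 (described in the context) is run with $0<\delta\le\delta_0$ and $\eta^0\ge\bar\eta$. Suppose that at some moment after its first iteration Algorithm 2 has generated $\theta$ cuts, let $\eta^*$ and $s^*$ be its current best parameter and support, and let $s^\theta$ be an optimal solution of the problem of maximizing $\sum_{i=1}^p s_i\|X_i\|^2$ over $s\in\{0,1\}^p$ subject to $\sum_{i=1}^p s_i\le k$ and the $\theta$ cuts generated. If $f(\eta^* )\ge\sum_{i=1}^p s^\theta_i\|X_i\|^2$, then $s^*$ is an optimal solution of $(P)$. Otherwise, the optimal value of $(P)$ is at most $\sum_{i=1}^p s^\theta_i\|X_i\|^2$.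
   Context: $[p]=\{1,\dots,p\}$. For $s\in\{0,1\}^p$, $X(s)$ is the matrix obtained from $X$ by deleting every column $X_i$ with $s_i=0$ (empty matrix of norm $0$ if $s=0$). $U[s]$ is any element of $\operatorname{argmax}\{\mathrm{tr}(U^TX(s)X(s)^TU): U\in\mathbb{R}^{n\times a},\ U^TU=I_a\}$; $\eta(s)=\|X(s)-U[s]U[s]^TX(s)\|_F^2$ and $\pi(s)=\|U[s]U[s]^TX(s)\|_F^2$, with $\|\cdot\|_F$ the Frobenius norm. A vector $s$ is called an optimal solution of $(P)$ if $(s,U[s])$ is optimal for $(P)$. Centered means that each column of $X$ sums to zero. Algorithm 1 (input: a parameter $\eta$ and a set of cuts, i.e. linear inequalities of the form $\sum_{i\in\sigma}s_i\le|\sigma|-1$ with $\sigma\subset[p]$). Let $\phi$ be the problem of maximizing $\sum_{i=1}^p s_i\|X_i\|^2$ over $s\in\{0,1\}^p$ subject to $\sum_i s_i\le k$ and the input cuts. Compute an optimal solution $s$ of $\phi$. While $\eta(s)>\eta$: add to $\phi$ the cut $\sum_{i\in\sigma}s_i\le|\sigma|-1$ with $\sigma=\{i:s_i=1\}$ for the current $s$, and recompute an optimal solution $s$ of $\phi$. Return $s$. Algorithm 2 (parameters $\eta^0,\delta,\lambda$). Start with $\eta^*=\eta^0$ and counter $c=0$. For $t=0,1,2,\dots$, while $c\le\lambda$: run Algorithm 1 with parameter $\eta^t$ and all cuts generated so far, obtaining a support $s^t$, and let $f(\eta^t)=\pi(s^t)$; if $f(\eta^* )<f(\eta^t)$, set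 $\eta^*:=\eta^t$; set $\eta^{t+1}:=\eta(s^t)-\delta$ and $c:=c+1$. Throughout, $s^*$ is the support $s^t$ found for $\eta^t=\eta^*$. Return $s^*,\eta^*,f(\eta^* )$. If the problem $\phi$ becomes infeasible, the algorithm stops and returns the current $s^*,\eta^*,f(\eta^* )$. *)

theory Defs
  imports Complex_Main "Jordan_Normal_Form.Matrix"
begin

definition mat_trace :: "real mat \<Rightarrow> real" where
  "mat_trace A = (\<Sum>i<dim_row A. A $$ (i, i))"

definition frob_norm :: "real mat \<Rightarrow> real" where
  "frob_norm A = sqrt (\<Sum>i<dim_row A. \<Sum>j<dim_col A. (A $$ (i, j))\<^sup>2)"

definition eucl_norm :: "real vec \<Rightarrow> real" where
  "eucl_norm v = sqrt (v \<bullet> v)"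

definition centered :: "real mat \<Rightarrow> bool" where
  "centered X \<longleftrightarrow> (\<forall>j<dim_col X. (\<Sum>i<dim_row X. X $$ (i, j)) = 0)"

text \<open>Columns, and hence the entries of a 0/1 vector, are indexed from 0 to p - 1.\<close>

definition binary_vecs :: "nat \<Rightarrow> real vec set" where
  "binary_vecs p = {s \<in> carrier_vec p. \<forall>i<p. s $ i = 0 \<or> s $ i = 1}"

definition support :: "real vec \<Rightarrow> nat set" where
  "support s = {i. i < dim_vec s \<and> s $ i = 1}"

text \<open>For s = 0 this is the matrix with no columns.\<close>

definition restrict_cols :: "real mat \<Rightarrow> real vec \<Rightarrow> real mat" where
  "restrict_cols X s = mat_of_cols (dim_row X) [col X i. i \<leftarrow> [0..<dim_col X], s $ i \<noteq> 0]"

definition orthonormal_cols :: "nat \<Rightarrow> nat \<Rightarrow> real mat set" where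
  "orthonormal_cols n a = {U \<in> carrier_mat n a. U\<^sup>T * U = 1\<^sub>m a}"

text \<open>
  A map U that selects, for every 0/1 vector s, some maximizer U s of the trace problem
  for the restricted matrix. Values of U at other vectors are irrelevant.
\<close>

definition loading_selection :: "real mat \<Rightarrow> nat \<Rightarrow> (real vec \<Rightarrow> real mat) \<Rightarrow> bool" where
  "loading_selection X a U \<longleftrightarrow>
     (\<forall>s \<in> binary_vecs (dim_col X).
        is_arg_max (\<lambda>V. mat_trace (V\<^sup>T * restrict_cols X s * (restrict_cols X s)\<^sup>T * V))
          (\<lambda>V. V \<in> orthonormal_cols (dim_row X) a) (U s))"

definition resid :: "real mat \<Rightarrow> (real vec \<Rightarrow> real mat) \<Rightarrow> real vec \<Rightarrow> real" where
  "resid X U s = (frob_norm (restrict_cols X s - U s * (U s)\<^sup>T * restrict_cols X s))\<^sup>2"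

definition explained :: "real mat \<Rightarrow> (real vec \<Rightarrow> real mat) \<Rightarrow> real vec \<Rightarrow> real" where
  "explained X U s = (frob_norm (U s * (U s)\<^sup>T * restrict_cols X s))\<^sup>2"

definition P_feasible :: "real mat \<Rightarrow> nat \<Rightarrow> nat \<Rightarrow> (real vec \<times> real mat) set" where
  "P_feasible X a k = {(s, U). s \<in> binary_vecs (dim_col X) \<and> U \<in> orthonormal_cols (dim_row X) a \<and>
      (\<Sum>i<dim_col X. s $ i) \<le> real k}"

definition P_objective :: "real mat \<Rightarrow> nat \<Rightarrow> real vec \<times> real mat \<Rightarrow> real" where
  "P_objective X a = (\<lambda>(s, U). \<Sum>i<dim_col X. s $ i * (\<Sum>j<a. (col X i \<bullet> col U j)\<^sup>2))"

definition P_optimal :: "real mat \<Rightarrow> nat \<Rightarrow> nat \<Rightarrow> real vec \<times> real mat \<Rightarrow> bool" where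
  "P_optimal X a k = is_arg_max (P_objective X a) (\<lambda>x. x \<in> P_feasible X a k)"

definition P_value :: "real mat \<Rightarrow> nat \<Rightarrow> nat \<Rightarrow> real" where
  "P_value X a k = (SUP x \<in> P_feasible X a k. P_objective X a x)"

text \<open>
  A cut is represented by its index set \<open>\<sigma>\<close>. The right-hand side is taken in the reals, so
  the cut of the empty set reads 0 \<open>\<le>\<close> -1 and makes the problem infeasible.
\<close>

definition satisfies_cut :: "real vec \<Rightarrow> nat set \<Rightarrow> bool" where
  "satisfies_cut s \<sigma> \<longleftrightarrow> (\<Sum>i\<in>\<sigma>. s $ i) \<le> real (card \<sigma>) - 1"

definition weight :: "real mat \<Rightarrow> real vec \<Rightarrow> real" where
  "weight X s = (\<Sum>i<dim_col X. s $ i * (eucl_norm (col X i))\<^sup>2)"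

definition phi_feasible :: "real mat \<Rightarrow> nat \<Rightarrow> nat set set \<Rightarrow> real vec \<Rightarrow> bool" where
  "phi_feasible X k C s \<longleftrightarrow> s \<in> binary_vecs (dim_col X) \<and> (\<Sum>i<dim_col X. s $ i) \<le> real k \<and>
     (\<forall>\<sigma>\<in>C. satisfies_cut s \<sigma>)"

definition phi_optimal :: "real mat \<Rightarrow> nat \<Rightarrow> nat set set \<Rightarrow> real vec \<Rightarrow> bool" where
  "phi_optimal X k C = is_arg_max (weight X) (phi_feasible X k C)"

text \<open>
  Small-step semantics, so that intermediate moments of a run are states as well; the choice
  among several optimal solutions is nondeterministic. In a state (C, m) of Algorithm 1, C is
  the set of cuts present in the problem; m is None when an optimal solution has to be
  (re)computed, and Some s when s is the current one. Algorithm 1 returns s from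
  (C, Some s) as soon as the residual of s does not exceed the parameter \<open>\<eta>\<close>.
\<close>

inductive alg1_step ::
  "real mat \<Rightarrow> nat \<Rightarrow> (real vec \<Rightarrow> real mat) \<Rightarrow> real \<Rightarrow>
   nat set set \<times> real vec option \<Rightarrow> nat set set \<times> real vec option \<Rightarrow> bool"
  for X k U \<eta> where
  solve: "phi_optimal X k C s \<Longrightarrow> alg1_step X k U \<eta> (C, None) (C, Some s)"
| cut: "resid X U s > \<eta> \<Longrightarrow> alg1_step X k U \<eta> (C, Some s) (insert (support s) C, None)"

datatype phase = Head | In_Alg1 "real vec option" | Stopped

text \<open>
  The counter c always equals the iteration index t, so only one of them is kept; it is also
  the number of completed iterations. The functions fval and supp record, for each parameter
  value already processed, the value f of that parameter and the support found for it.
\<close>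

record alg2_state =
  phase :: phase
  cuts :: "nat set set"
  counter :: nat
  eta_cur :: real
  eta_best :: real
  fval :: "real \<Rightarrow> real"
  supp :: "real \<Rightarrow> real vec"

definition alg2_init :: "real \<Rightarrow> alg2_state" where
  "alg2_init \<eta>\<^sub>0 = \<lparr>phase = Head, cuts = {}, counter = 0, eta_cur = \<eta>\<^sub>0, eta_best = \<eta>\<^sub>0,
     fval = undefined, supp = undefined\<rparr>"

definition alg2_update ::
  "real mat \<Rightarrow> (real vec \<Rightarrow> real mat) \<Rightarrow> real \<Rightarrow> real vec \<Rightarrow> alg2_state \<Rightarrow> alg2_state" where
  "alg2_update X U \<delta> s st =
     (let f = (fval st)(eta_cur st := explained X U s)
      in st\<lparr>phase := Head, counter := counter st + 1, eta_cur := resid X U s - \<delta>,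
            eta_best := (if f (eta_best st) < f (eta_cur st) then eta_cur st else eta_best st),
            fval := f, supp := (supp st)(eta_cur st := s)\<rparr>)"

inductive alg2_step ::
  "real mat \<Rightarrow> nat \<Rightarrow> (real vec \<Rightarrow> real mat) \<Rightarrow> real \<Rightarrow> nat \<Rightarrow> alg2_state \<Rightarrow> alg2_state \<Rightarrow> bool"
  for X k U \<delta> lam where
  call: "\<lbrakk>phase st = Head; counter st \<le> lam\<rbrakk>
    \<Longrightarrow> alg2_step X k U \<delta> lam st (st\<lparr>phase := In_Alg1 None\<rparr>)"
| finish: "\<lbrakk>phase st = Head; \<not> counter st \<le> lam\<rbrakk>
    \<Longrightarrow> alg2_step X k U \<delta> lam st (st\<lparr>phase := Stopped\<rparr>)"
| run: "\<lbrakk>phase st = In_Alg1 m; alg1_step X k U (eta_cur st) (cuts st, m) (C', m')\<rbrakk>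
    \<Longrightarrow> alg2_step X k U \<delta> lam st (st\<lparr>phase := In_Alg1 m', cuts := C'\<rparr>)"
| return: "\<lbrakk>phase st = In_Alg1 (Some s); \<not> resid X U s > eta_cur st\<rbrakk>
    \<Longrightarrow> alg2_step X k U \<delta> lam st (alg2_update X U \<delta> s st)"
| infeasible: "\<lbrakk>phase st = In_Alg1 None; \<nexists>s. phi_feasible X k (cuts st) s\<rbrakk>
    \<Longrightarrow> alg2_step X k U \<delta> lam st (st\<lparr>phase := Stopped\<rparr>)"

definition alg2_reaches ::
  "real mat \<Rightarrow> nat \<Rightarrow> (real vec \<Rightarrow> real mat) \<Rightarrow> real \<Rightarrow> real \<Rightarrow> nat \<Rightarrow> alg2_state \<Rightarrow> bool" where
  "alg2_reaches X k U \<eta>\<^sub>0 \<delta> lam = (alg2_step X k U \<delta> lam)\<^sup>*\<^sup>* (alg2_init \<eta>\<^sub>0)"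

definition f_best :: "alg2_state \<Rightarrow> real" where
  "f_best st = fval st (eta_best st)"

definition s_best :: "alg2_state \<Rightarrow> real vec" where
  "s_best st = supp st (eta_best st)"

end

theory Submission
  imports Defs
begin

text \<open>
  By Pythagoras, the weight of \<open>s\<close> is \<open>\<eta>(s) + \<pi>(s)\<close>, so \<open>\<pi>(s)\<close> is bounded by the weight. The
  residual \<open>\<eta>\<close> is monotone in the support, so a cut generated with parameter \<open>\<eta>\<close> removes only
  vectors whose residual exceeds \<open>\<eta>\<close>. If \<open>\<delta>\<close> is at most the smallest gap between
  distinct residuals, then a residual exceeding \<open>\<eta>(s\<^sup>t) - \<delta>\<close> is at least \<open>\<eta>(s\<^sup>t)\<close>; hence
  a vector removed for the first time after \<open>s\<^sup>t\<close> was found has both smaller weight and larger residual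
  than \<open>s\<^sup>t\<close>, and so a value \<open>\<pi>\<close> of at most \<open>\<pi>(s\<^sup>t) \<le> f(\<eta>\<^sup>*)\<close>. Every
  vector that survives the cuts has \<open>\<pi>\<close> at most the weight of \<open>s\<^sup>\<theta>\<close>.
\<close>

section \<open>Frobenius norms and traces as sums over columns\<close>

lemma frob_norm_sq: "(frob_norm A)\<^sup>2 = (\<Sum>j<dim_col A. col A j \<bullet> col A j)"
proof -
  have "(frob_norm A)\<^sup>2 = (\<Sum>i<dim_row A. \<Sum>j<dim_col A. (A $$ (i, j))\<^sup>2)"
    by (simp add: frob_norm_def sum_nonneg)
  also have "\<dots> = (\<Sum>j<dim_col A. \<Sum>i<dim_row A. (A $$ (i, j))\<^sup>2)"
    by (rule sum.swap)
  also have "\<dots> = (\<Sum>j<dim_col A. col A j \<bullet> col A j)"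
    by (intro sum.cong) (auto simp: scalar_prod_def power2_eq_square lessThan_atLeast0)
  finally show ?thesis .
qed

lemma trace_mult_transpose: "mat_trace (W * W\<^sup>T) = (frob_norm W)\<^sup>2"
  by (simp add: mat_trace_def frob_norm_def sum_nonneg scalar_prod_def power2_eq_square
      lessThan_atLeast0)

text \<open>The 0/1 entries of \<open>s\<close> act as indicators, so every columnwise quantity of
  the restricted matrix becomes a sum over all columns of \<open>X\<close>, linear in
  \<open>s\<close>.\<close>

lemma sum_cols_restrict_cols:
  assumes "s \<in> binary_vecs (dim_col X)"
  shows "(\<Sum>j<dim_col (restrict_cols X s). g (col (restrict_cols X s) j)) =
    (\<Sum>i<dim_col X. s $ i * g (col X i))"
proof -
  let ?is = "filter (\<lambda>i. s $ i \<noteq> 0) [0..<dim_col X]"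
  have cols: "restrict_cols X s = mat_of_cols (dim_row X) (map (col X) ?is)"
  proof -
    \<comment> \<open>The list comprehension in \<open>restrict_cols\<close> is syntax for this
      \<open>concat\<close>.\<close>
    have "concat (map (\<lambda>i. if s $ i \<noteq> 0 then [col X i] else []) is) =
        map (col X) (filter (\<lambda>i. s $ i \<noteq> 0) is)" for "is"
      by (induction "is") auto
    then show ?thesis
      by (simp add: restrict_cols_def)
  qed
  have "(\<Sum>j<dim_col (restrict_cols X s). g (col (restrict_cols X s) j)) =
      (\<Sum>j<length ?is. g (col X (?is ! j)))"
    unfolding cols by (intro sum.cong) (auto simp: col_mat_of_cols)
  also have "\<dots> = (\<Sum>i\<leftarrow>?is. g (col X i))"
    by (simp add: sum_list_sum_nth lessThan_atLeast0)
  also have "\<dots> = (\<Sum>i\<in>set ?is. g (col X i))"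
    by (rule sum_list_distinct_conv_sum_set) simp
  also have "\<dots> = (\<Sum>i<dim_col X. if s $ i \<noteq> 0 then g (col X i) else 0)"
    by (subst sum.inter_filter[symmetric]) (auto intro!: sum.cong)
  also have "\<dots> = (\<Sum>i<dim_col X. s $ i * g (col X i))"
    using assms by (intro sum.cong) (auto simp: binary_vecs_def)
  finally show ?thesis .
qed

lemma mult_col: "j < dim_col B \<Longrightarrow> col (A * B) j = A *\<^sub>v col B j"
  by (intro eq_vecI) auto

lemma transpose_mult_vec_sq:
  "(V\<^sup>T *\<^sub>v y) \<bullet> (V\<^sup>T *\<^sub>v y) = (\<Sum>j<dim_col V. (col V j \<bullet> y)\<^sup>2)" for V :: "real mat"
  by (simp add: scalar_prod_def[of "_ *\<^sub>v _"] power2_eq_square lessThan_atLeast0)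

section \<open>Orthogonal projection onto the span of orthonormal columns\<close>

context
  fixes V :: "real mat" and n a :: nat
  assumes V: "V \<in> orthonormal_cols n a"
begin

lemma V_carrier: "V \<in> carrier_mat n a" and V_transpose_mult: "V\<^sup>T * V = 1\<^sub>m a"
  using V by (auto simp: orthonormal_cols_def)

lemma projection_mult_vec:
  assumes "y \<in> carrier_vec n"
  shows "(V * V\<^sup>T) *\<^sub>v y = V *\<^sub>v (V\<^sup>T *\<^sub>v y)"
  using assms V_carrier by (intro assoc_mult_mat_vec) auto

text \<open>Both sides reduce to the squared length of \<open>V\<^sup>T *\<^sub>v y\<close>:
  adjointness moves \<open>V\<close> across the scalar product, and for the first claim
  \<open>V\<^sup>T * V\<close> cancels.\<close>

lemma projection_sq:
  assumes y: "y \<in> carrier_vec n"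
  shows "((V * V\<^sup>T) *\<^sub>v y) \<bullet> ((V * V\<^sup>T) *\<^sub>v y) = (\<Sum>j<a. (y \<bullet> col V j)\<^sup>2)"
    and "y \<bullet> ((V * V\<^sup>T) *\<^sub>v y) = (\<Sum>j<a. (y \<bullet> col V j)\<^sup>2)"
proof -
  let ?w = "V\<^sup>T *\<^sub>v y"
  note Vc = V_carrier
  have w: "?w \<in> carrier_vec a"
    using Vc y by auto
  have adj: "z \<bullet> (V *\<^sub>v ?w) = (V\<^sup>T *\<^sub>v z) \<bullet> ?w" if "z \<in> carrier_vec n" for z
    using transpose_vec_mult_scalar[OF Vc w that] by (rule sym)
  have sq: "?w \<bullet> ?w = (\<Sum>j<a. (y \<bullet> col V j)\<^sup>2)"
    unfolding transpose_mult_vec_sq using Vc y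
    by (intro sum.cong) (auto simp: comm_scalar_prod[of y n])
  have "V\<^sup>T *\<^sub>v (V *\<^sub>v ?w) = (V\<^sup>T * V) *\<^sub>v ?w"
    using Vc w by (intro assoc_mult_mat_vec[symmetric]) auto
  then have ww: "V\<^sup>T *\<^sub>v (V *\<^sub>v ?w) = ?w"
    using w V_transpose_mult by simp
  show "((V * V\<^sup>T) *\<^sub>v y) \<bullet> ((V * V\<^sup>T) *\<^sub>v y) = (\<Sum>j<a. (y \<bullet> col V j)\<^sup>2)"
    unfolding projection_mult_vec[OF y] using adj[of "V *\<^sub>v ?w"] Vc w ww sq by auto
  show "y \<bullet> ((V * V\<^sup>T) *\<^sub>v y) = (\<Sum>j<a. (y \<bullet> col V j)\<^sup>2)"
    unfolding projection_mult_vec[OF y] using adj[OF y] sq by simp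
qed

lemma residual_sq:
  assumes y: "y \<in> carrier_vec n"
  shows "(y - (V * V\<^sup>T) *\<^sub>v y) \<bullet> (y - (V * V\<^sup>T) *\<^sub>v y) = y \<bullet> y - (\<Sum>j<a. (y \<bullet> col V j)\<^sup>2)"
proof -
  let ?z = "(V * V\<^sup>T) *\<^sub>v y"
  have z: "?z \<in> carrier_vec n"
    using V_carrier y by (intro mult_mat_vec_carrier[of _ n n]) auto
  have "(y - ?z) \<bullet> (y - ?z) = y \<bullet> y - y \<bullet> ?z - (?z \<bullet> y - ?z \<bullet> ?z)"
    using y z by (simp add: minus_scalar_prod_distrib scalar_prod_minus_distrib)
  then show ?thesis
    using projection_sq[OF y] comm_scalar_prod[OF y z] by simp
qed

lemma Bessel:
  assumes "y \<in> carrier_vec n"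
  shows "(\<Sum>j<a. (y \<bullet> col V j)\<^sup>2) \<le> y \<bullet> y"
proof -
  have "0 \<le> (y - (V * V\<^sup>T) *\<^sub>v y) \<bullet> (y - (V * V\<^sup>T) *\<^sub>v y)"
    by (auto simp: scalar_prod_def intro: sum_nonneg)
  then show ?thesis
    using residual_sq[OF assms] by simp
qed

text \<open>In this form each coefficient of \<open>s $ i\<close> is nonnegative by
  \<open>Bessel\<close>, which is the source of the monotonicity of the residual.\<close>

lemma weight_minus_P_objective:
  assumes "dim_row X = n"
  shows "weight X s - P_objective X a (s, V) =
    (\<Sum>i<dim_col X. s $ i * (col X i \<bullet> col X i - (\<Sum>j<a. (col X i \<bullet> col V j)\<^sup>2)))"
proof -
  have "(eucl_norm v)\<^sup>2 = v \<bullet> v" for v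
    by (simp add: eucl_norm_def scalar_prod_def sum_nonneg)
  then show ?thesis
    by (simp add: weight_def P_objective_def sum_subtractf[symmetric] right_diff_distrib)
qed

context
  fixes X :: "real mat" and s :: "real vec"
  assumes X: "dim_row X = n" and s: "s \<in> binary_vecs (dim_col X)"
begin

lemma dim_row_restrict_cols: "dim_row (restrict_cols X s) = n"
  using X by (simp add: restrict_cols_def)

lemma col_restrict_cols: "col (restrict_cols X s) j \<in> carrier_vec n"
  using col_dim[of "restrict_cols X s" j] unfolding dim_row_restrict_cols .

lemma frob_norm_projection:
  "(frob_norm (V * V\<^sup>T * restrict_cols X s))\<^sup>2 = P_objective X a (s, V)"
proof -
  let ?Y = "restrict_cols X s"
  have "(frob_norm (V * V\<^sup>T * ?Y))\<^sup>2 = (\<Sum>j<dim_col ?Y. (\<Sum>l<a. (col ?Y j \<bullet> col V l)\<^sup>2))"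
    unfolding frob_norm_sq
    by (intro sum.cong) (auto simp: mult_col projection_sq(1) col_restrict_cols)
  also have "\<dots> = P_objective X a (s, V)"
    using sum_cols_restrict_cols[OF s, of "\<lambda>y. \<Sum>l<a. (y \<bullet> col V l)\<^sup>2"]
    by (simp add: P_objective_def)
  finally show ?thesis .
qed

lemma frob_norm_residual:
  "(frob_norm (restrict_cols X s - V * V\<^sup>T * restrict_cols X s))\<^sup>2 =
    weight X s - P_objective X a (s, V)"
proof -
  let ?Y = "restrict_cols X s"
  have "col (?Y - V * V\<^sup>T * ?Y) j = col ?Y j - (V * V\<^sup>T) *\<^sub>v col ?Y j"
    if "j < dim_col ?Y" for j
    using that V_carrier
    by (simp add: mult_col[symmetric]) (intro eq_vecI, auto simp: dim_row_restrict_cols)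
  then have "(frob_norm (?Y - V * V\<^sup>T * ?Y))\<^sup>2 =
      (\<Sum>j<dim_col ?Y. col ?Y j \<bullet> col ?Y j - (\<Sum>l<a. (col ?Y j \<bullet> col V l)\<^sup>2))"
    unfolding frob_norm_sq
    by (intro sum.cong) (auto simp: residual_sq col_restrict_cols)
  also have "\<dots> = weight X s - P_objective X a (s, V)"
    using sum_cols_restrict_cols[OF s, of "\<lambda>y. y \<bullet> y - (\<Sum>l<a. (y \<bullet> col V l)\<^sup>2)"]
    by (simp add: weight_minus_P_objective[OF X])
  finally show ?thesis .
qed

text \<open>The matrix under the trace is \<open>W * W\<^sup>T\<close> with
  \<open>W = V\<^sup>T * restrict_cols X s\<close>. This identifies the trace problem that defines
  the loadings with (P) for fixed \<open>s\<close>.\<close>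

lemma trace_eq_P_objective:
  "mat_trace (V\<^sup>T * restrict_cols X s * (restrict_cols X s)\<^sup>T * V) = P_objective X a (s, V)"
proof -
  let ?Y = "restrict_cols X s"
  obtain m where Yc: "?Y \<in> carrier_mat n m"
    using dim_row_restrict_cols by blast
  note Vc = V_carrier
  have "V\<^sup>T * ?Y * ?Y\<^sup>T * V = (V\<^sup>T * ?Y) * (V\<^sup>T * ?Y)\<^sup>T"
    using Vc Yc assoc_mult_mat[of "V\<^sup>T * ?Y" a m "?Y\<^sup>T" n V a]
    by (simp add: transpose_mult[of _ a n _ m])
  then have "mat_trace (V\<^sup>T * ?Y * ?Y\<^sup>T * V) = (frob_norm (V\<^sup>T * ?Y))\<^sup>2"
    by (simp add: trace_mult_transpose)
  also have "\<dots> = (\<Sum>j<dim_col ?Y. (\<Sum>l<a. (col ?Y j \<bullet> col V l)\<^sup>2))"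
    unfolding frob_norm_sq using Vc
    by (intro sum.cong)
      (auto simp: mult_col transpose_mult_vec_sq comm_scalar_prod[OF col_restrict_cols] intro!: sum.cong)
  also have "\<dots> = P_objective X a (s, V)"
    using sum_cols_restrict_cols[OF s, of "\<lambda>y. \<Sum>l<a. (y \<bullet> col V l)\<^sup>2"]
    by (simp add: P_objective_def)
  finally show ?thesis .
qed

end

end

section \<open>Residual and explained part for selected loadings\<close>

context
  fixes X :: "real mat" and a :: nat and U :: "real vec \<Rightarrow> real mat"
  assumes U: "loading_selection X a U"
begin

lemma loading_orthonormal:
  "s \<in> binary_vecs (dim_col X) \<Longrightarrow> U s \<in> orthonormal_cols (dim_row X) a"
  using U by (auto simp: loading_selection_def is_arg_max_def)

lemma explained_eq:
  "s \<in> binary_vecs (dim_col X) \<Longrightarrow> explained X U s = P_objective X a (s, U s)"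
  unfolding explained_def by (rule frob_norm_projection[OF loading_orthonormal]) auto

lemma resid_eq:
  "s \<in> binary_vecs (dim_col X) \<Longrightarrow> resid X U s = weight X s - explained X U s"
  unfolding resid_def explained_eq by (rule frob_norm_residual[OF loading_orthonormal]) auto

lemma resid_nonneg: "0 \<le> resid X U s" and explained_nonneg: "0 \<le> explained X U s"
  by (simp_all add: resid_def explained_def)

lemma P_objective_le_explained:
  assumes s: "s \<in> binary_vecs (dim_col X)" and V: "V \<in> orthonormal_cols (dim_row X) a"
  shows "P_objective X a (s, V) \<le> explained X U s"
proof -
  let ?tr = "\<lambda>V. mat_trace (V\<^sup>T * restrict_cols X s * (restrict_cols X s)\<^sup>T * V)"
  have "?tr V \<le> ?tr (U s)"
    using U s V by (force simp: loading_selection_def is_arg_max_def)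
  then show ?thesis
    unfolding explained_eq[OF s] trace_eq_P_objective[OF V refl s]
      trace_eq_P_objective[OF loading_orthonormal[OF s] refl s] .
qed

text \<open>The right-hand side does not mention \<open>U\<close>: the explained part, and with it
  the residual, is the same for every selection of maximizers.\<close>

lemma explained_eq_SUP:
  assumes s: "s \<in> binary_vecs (dim_col X)"
  shows "explained X U s = (SUP V\<in>orthonormal_cols (dim_row X) a. P_objective X a (s, V))"
  by (rule cSup_eq_maximum[symmetric])
    (use P_objective_le_explained[OF s] explained_eq[OF s] loading_orthonormal[OF s] in auto)

text \<open>Take the loadings of the larger vector \<open>s'\<close> for both. Dropping columns
  drops nonnegative terms, and passing from \<open>U s'\<close> to the loadings optimal for
  \<open>s\<close> can only decrease the residual of \<open>s\<close> further.\<close>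

lemma resid_mono:
  assumes s: "s \<in> binary_vecs (dim_col X)" and s': "s' \<in> binary_vecs (dim_col X)"
    and sub: "support s \<subseteq> support s'"
  shows "resid X U s \<le> resid X U s'"
proof -
  note V = loading_orthonormal[OF s']
  have "s $ i \<le> s' $ i" if "i < dim_col X" for i
    using that s s' sub by (fastforce simp: binary_vecs_def support_def)
  then have "weight X s - P_objective X a (s, U s') \<le> weight X s' - P_objective X a (s', U s')"
    unfolding weight_minus_P_objective[OF V refl]
    by (intro sum_mono mult_right_mono) (auto intro!: Bessel[OF V])
  moreover have "P_objective X a (s, U s') \<le> explained X U s"
    by (rule P_objective_le_explained[OF s V])
  ultimately show ?thesis
    using s s' by (simp add: resid_eq explained_eq)
qed

end

section \<open>Cuts, feasible vectors and the invariant\<close>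

text \<open>If \<open>s'\<close> vanished at some index of the support of \<open>s\<close>, its sum
  over that support would be at most the cardinality minus 1, and the cut would hold.\<close>

lemma not_satisfies_cut_support:
  assumes s': "s' \<in> binary_vecs p" and s: "s \<in> binary_vecs p"
    and cut: "\<not> satisfies_cut s' (support s)"
  shows "support s \<subseteq> support s'"
proof
  fix i assume i: "i \<in> support s"
  have fin: "finite (support s)"
    by (simp add: support_def)
  have bin: "s' $ j = 0 \<or> s' $ j = 1" if "j \<in> support s" for j
    using that s s' by (auto simp: binary_vecs_def support_def)
  have "s' $ i = 1"
  proof (rule ccontr)
    assume "s' $ i \<noteq> 1"
    then have "s' $ i = 0"
      using bin[OF i] by simp
    then have "(\<Sum>j\<in>support s. s' $ j) = (\<Sum>j\<in>support s - {i}. s' $ j)"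
      using fin i by (simp add: sum.remove)
    also have "\<dots> \<le> (\<Sum>j\<in>support s - {i}. 1)"
      using bin by (intro sum_mono) force
    \<comment> \<open>The support contains \<open>i\<close>, so its cardinality is positive and the
      subtraction in the naturals is not truncated.\<close>
    also have "\<dots> = real (card (support s)) - 1"
      using fin i by (simp add: card_Diff_singleton of_nat_diff card_gt_0_iff Suc_le_eq)
        (metis One_nat_def Suc_leI card_gt_0_iff empty_iff of_nat_1 of_nat_diff)
    finally show False
      using cut by (simp add: satisfies_cut_def)
  qed
  then show "i \<in> support s'"
    using i s s' by (auto simp: support_def binary_vecs_def)
qed

lemma phi_feasible_empty_iff:
  "phi_feasible X k {} s \<longleftrightarrow> s \<in> binary_vecs (dim_col X) \<and> (\<Sum>i<dim_col X. s $ i) \<le> real k"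
  by (simp add: phi_feasible_def)

lemma phi_feasible_empty: "phi_feasible X k C s \<Longrightarrow> phi_feasible X k {} s"
  by (simp add: phi_feasible_def)

lemma phi_optimalD:
  assumes "phi_optimal X k C s"
  shows "phi_feasible X k C s" and "phi_feasible X k C s' \<Longrightarrow> weight X s' \<le> weight X s"
  using assms by (auto simp: phi_optimal_def is_arg_max_def not_less)

text \<open>
  In the second conjunct, \<open>eta_best st > eta_cur st\<close> ensures that the next update does not
  overwrite the entries of \<open>fval\<close> and \<open>supp\<close> stored at \<open>eta_best st\<close>.
\<close>

definition alg2_inv :: "real mat \<Rightarrow> nat \<Rightarrow> (real vec \<Rightarrow> real mat) \<Rightarrow> real \<Rightarrow> alg2_state \<Rightarrow> bool" where
  "alg2_inv X k U B st \<longleftrightarrow>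
    (\<forall>s. phase st = In_Alg1 (Some s) \<longrightarrow> phi_optimal X k (cuts st) s) \<and>
    (if counter st = 0 then cuts st = {} \<and> eta_best st = eta_cur st \<and> B \<le> eta_cur st
     else eta_cur st < eta_best st \<and> phi_feasible X k {} (s_best st) \<and>
       f_best st = explained X U (s_best st) \<and>
       (\<forall>s. phi_feasible X k {} s \<longrightarrow> \<not> phi_feasible X k (cuts st) s \<or> eta_cur st < resid X U s
          \<longrightarrow> explained X U s \<le> f_best st))"

section \<open>Preservation of the invariant along a run\<close>

context
  fixes X :: "real mat" and a k :: nat and U :: "real vec \<Rightarrow> real mat" and \<delta> B :: real
  assumes U: "loading_selection X a U" and \<delta>: "0 < \<delta>"
    and gap: "\<And>s s'. s \<in> binary_vecs (dim_col X) \<Longrightarrow> s' \<in> binary_vecs (dim_col X) \<Longrightarrow>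
      resid X U s' - \<delta> < resid X U s \<Longrightarrow> resid X U s' \<le> resid X U s"
    and B: "\<And>s. s \<in> binary_vecs (dim_col X) \<Longrightarrow> resid X U s \<le> B"
begin

lemma resid_of_new_cut:
  assumes "phi_feasible X k {} s'" "phi_feasible X k C s'"
    "\<not> phi_feasible X k (insert (support s) C) s'" "phi_feasible X k {} s"
  shows "resid X U s \<le> resid X U s'"
proof -
  have "\<not> satisfies_cut s' (support s)"
    using assms by (auto simp: phi_feasible_def)
  then show ?thesis
    using assms not_satisfies_cut_support resid_mono[OF U]
    by (auto simp: phi_feasible_empty_iff)
qed

lemma alg2_inv_update:
  assumes inv: "alg2_inv X k U B st" and opt: "phi_optimal X k (cuts st) s"
    and le: "resid X U s \<le> eta_cur st"
  shows "alg2_inv X k U B (alg2_update X U \<delta> s st)"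
proof -
  let ?st = "alg2_update X U \<delta> s st"
  note upd = alg2_update_def Let_def f_best_def s_best_def
  have s: "phi_feasible X k {} s"
    using phi_optimalD(1)[OF opt] by (rule phi_feasible_empty)
  have basic: "phase ?st = Head" "cuts ?st = cuts st" "counter ?st = Suc (counter st)"
      "eta_cur ?st = resid X U s - \<delta>"
    by (simp_all add: upd)
  \<comment> \<open>Since \<open>resid X U s \<le> eta_cur st\<close> and \<delta> is positive, the
    parameter strictly decreases. In the first iteration \<open>eta_best st = eta_cur st\<close>, so
    f is compared with itself: \<open>eta_best\<close> stays, and the undefined entries there are
    replaced by those of \<open>s\<close>.\<close>
  have best: "eta_cur ?st < eta_best ?st \<and> phi_feasible X k {} (s_best ?st) \<and>
      f_best ?st = explained X U (s_best ?st) \<and> explained X U s \<le> f_best ?st \<and>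
      (counter st \<noteq> 0 \<longrightarrow> f_best st \<le> f_best ?st)"
    using inv s le \<delta> by (auto simp: alg2_inv_def upd split: if_splits)
  have "explained X U s' \<le> f_best ?st"
    if s': "phi_feasible X k {} s'"
      and dis: "\<not> phi_feasible X k (cuts st) s' \<or> resid X U s - \<delta> < resid X U s'" for s'
  proof (cases "phi_feasible X k (cuts st) s'")
    case True
    have bin: "s \<in> binary_vecs (dim_col X)" "s' \<in> binary_vecs (dim_col X)"
      using s s' by (auto simp: phi_feasible_empty_iff)
    have "weight X s' \<le> weight X s"
      using phi_optimalD(2)[OF opt True] .
    moreover have "resid X U s \<le> resid X U s'"
      \<comment> \<open>The gap closes the interval of length \<delta> below
        \<open>resid X U s\<close>: no residual lies strictly inside it.\<close>
      using gap[OF bin(2,1)] dis True by simp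
    ultimately have "explained X U s' \<le> explained X U s"
      using bin by (simp add: resid_eq[OF U])
    then show ?thesis
      using best by simp
  next
    case False
    \<comment> \<open>Before the first return there are no cuts, so a vector already removed belongs
      to a later iteration, where the old invariant covers it.\<close>
    then have "counter st \<noteq> 0"
      using inv s' by (auto simp: alg2_inv_def split: if_splits)
    moreover from this have "explained X U s' \<le> f_best st"
      using inv s' False by (auto simp: alg2_inv_def)
    ultimately show ?thesis
      using best by auto
  qed
  then show ?thesis
    using best by (simp add: alg2_inv_def basic)
qed

text \<open>A vector removed by the new cut has residual at least that of \<open>s\<close>, hence
  above \<open>eta_cur st\<close>. The invariant already bounds its explained part through the
  alternative \<open>eta_cur st < resid X U s\<close>, so a cut creates no new obligation.\<close>

lemma alg2_inv_cut:
  assumes inv: "alg2_inv X k U B st" and ph: "phase st = In_Alg1 (Some s)"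
    and gt: "eta_cur st < resid X U s"
  shows "alg2_inv X k U B (st\<lparr>phase := In_Alg1 None, cuts := insert (support s) (cuts st)\<rparr>)"
proof -
  have "phi_optimal X k (cuts st) s"
    using inv ph by (simp add: alg2_inv_def)
  then have s: "phi_feasible X k {} s"
    by (rule phi_feasible_empty[OF phi_optimalD(1)])
  \<comment> \<open>The initial parameter is at least \<open>B\<close>, which bounds every residual,
    so the first call of Algorithm 1 generates no cut.\<close>
  have c: "counter st \<noteq> 0"
    using inv gt B[of s] s by (auto simp: alg2_inv_def phi_feasible_empty_iff split: if_splits)
  have "explained X U s' \<le> f_best st"
    if s': "phi_feasible X k {} s'" "\<not> phi_feasible X k (insert (support s) (cuts st)) s'" for s'
  proof -
    have "\<not> phi_feasible X k (cuts st) s' \<or> eta_cur st < resid X U s'"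
      using resid_of_new_cut[OF s'(1) _ s'(2) s] gt by force
    then show ?thesis
      using inv c s' by (auto simp: alg2_inv_def)
  qed
  then show ?thesis
    using inv c by (auto simp: alg2_inv_def f_best_def s_best_def)
qed

lemma alg2_inv_step:
  assumes "alg2_step X k U \<delta> lam st st'" and inv: "alg2_inv X k U B st"
  shows "alg2_inv X k U B st'"
  using assms(1)
proof cases
  case (run m C' m')
  from run(3) show ?thesis
  proof cases
    case (solve s)
    then show ?thesis
      using inv run by (auto simp: alg2_inv_def f_best_def s_best_def)
  next
    case (cut s)
    then show ?thesis
      using alg2_inv_cut[OF inv] run by simp
  qed
next
  case (return s)
  then show ?thesis
    using alg2_inv_update[OF inv, of s] inv by (auto simp: alg2_inv_def)
qed (use inv in \<open>auto simp: alg2_inv_def f_best_def s_best_def\<close>)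

lemma alg2_inv_reaches:
  assumes "alg2_reaches X k U \<eta>\<^sub>0 \<delta> lam st" and "B \<le> \<eta>\<^sub>0"
  shows "alg2_inv X k U B st"
proof -
  have "alg2_inv X k U B (alg2_init \<eta>\<^sub>0)"
    using assms(2) by (simp add: alg2_inv_def alg2_init_def)
  with assms(1) show ?thesis
    unfolding alg2_reaches_def by (induction rule: rtranclp_induct) (auto intro: alg2_inv_step)
qed

section \<open>Consequences of the invariant for (P)\<close>

text \<open>A vector that survives the cuts competes with \<open>s\<theta>\<close>, a removed one is
  covered by the invariant. The maximum serves both branches of the final claim.\<close>

lemma alg2_inv_bound:
  assumes inv: "alg2_inv X k U B st" and c: "counter st \<noteq> 0"
    and opt: "phi_optimal X k (cuts st) s\<theta>" and feas: "(s, V) \<in> P_feasible X a k"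
  shows "P_objective X a (s, V) \<le> max (f_best st) (weight X s\<theta>)"
proof -
  have s: "phi_feasible X k {} s" and bin: "s \<in> binary_vecs (dim_col X)"
    using feas by (auto simp: P_feasible_def phi_feasible_empty_iff)
  have "P_objective X a (s, V) \<le> explained X U s"
    using feas by (intro P_objective_le_explained[OF U]) (auto simp: P_feasible_def)
  also have "\<dots> \<le> max (f_best st) (weight X s\<theta>)"
  proof (cases "phi_feasible X k (cuts st) s")
    case True
    then show ?thesis
      using phi_optimalD(2)[OF opt True] resid_eq[OF U bin] resid_nonneg[OF U, of s] by simp
  next
    case False
    then show ?thesis
      using inv c s by (auto simp: alg2_inv_def)
  qed
  finally show ?thesis .
qed

lemma alg2_inv_optimal:
  assumes inv: "alg2_inv X k U B st" and c: "counter st \<noteq> 0"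
    and opt: "phi_optimal X k (cuts st) s\<theta>" and le: "weight X s\<theta> \<le> f_best st"
  shows "P_optimal X a k (s_best st, U (s_best st))"
proof -
  let ?s = "s_best st"
  have s: "phi_feasible X k {} ?s" and f: "f_best st = explained X U ?s"
    using inv c by (auto simp: alg2_inv_def)
  then have "(?s, U ?s) \<in> P_feasible X a k" and "P_objective X a (?s, U ?s) = f_best st"
    by (auto simp: P_feasible_def phi_feasible_empty_iff loading_orthonormal[OF U]
        explained_eq[OF U])
  then show ?thesis
    using alg2_inv_bound[OF inv c opt] le
    by (force simp: P_optimal_def is_arg_max_def)
qed

lemma alg2_inv_P_value:
  assumes inv: "alg2_inv X k U B st" and c: "counter st \<noteq> 0"
    and opt: "phi_optimal X k (cuts st) s\<theta>" and less: "f_best st < weight X s\<theta>"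
  shows "P_value X a k \<le> weight X s\<theta>"
  unfolding P_value_def
proof (rule cSUP_least)
  \<comment> \<open>A supremum in the reals is bounded this way only over a nonempty set;
    \<open>s\<theta>\<close> with its loadings supplies a point.\<close>
  have "phi_feasible X k {} s\<theta>"
    using phi_optimalD(1)[OF opt] by (rule phi_feasible_empty)
  then have "(s\<theta>, U s\<theta>) \<in> P_feasible X a k"
    by (auto simp: P_feasible_def phi_feasible_empty_iff loading_orthonormal[OF U])
  then show "P_feasible X a k \<noteq> {}"
    by blast
next
  fix x assume "x \<in> P_feasible X a k"
  then show "P_objective X a x \<le> weight X s\<theta>"
    using alg2_inv_bound[OF inv c opt, of "fst x" "snd x"] less by simp
qed

end

section \<open>Choice of the constants\<close>

lemma finite_binary_vecs: "finite (binary_vecs p)"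
proof (rule finite_subset)
  show "binary_vecs p \<subseteq> (\<lambda>A. vec p (\<lambda>i. of_bool (i \<in> A))) ` Pow {..<p}"
  proof
    fix s assume s: "s \<in> binary_vecs p"
    then have "s = vec p (\<lambda>i. of_bool (i \<in> support s))" "support s \<in> Pow {..<p}"
      by (auto simp: binary_vecs_def support_def intro!: eq_vecI)
    then show "s \<in> (\<lambda>A. vec p (\<lambda>i. of_bool (i \<in> A))) ` Pow {..<p}"
      by blast
  qed
qed simp

lemma finite_set_gap:
  fixes A :: "real set"
  assumes "finite A"
  obtains d where "0 < d" "\<And>x y. x \<in> A \<Longrightarrow> y \<in> A \<Longrightarrow> y - d < x \<Longrightarrow> y \<le> x"
proof -
  \<comment> \<open>The smallest positive difference is the gap; the element 1 keeps the set
    nonempty when no two elements of \<open>A\<close> differ.\<close>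
  let ?D = "insert 1 {z \<in> (\<lambda>(x, y). y - x) ` (A \<times> A). 0 < z}"
  have D: "finite ?D" "?D \<noteq> {}"
    using assms by auto
  show thesis
  proof (rule that[of "Min ?D"])
    show "0 < Min ?D"
      using D by (subst Min_gr_iff) auto
    fix x y assume xy: "x \<in> A" "y \<in> A" "y - Min ?D < x"
    show "y \<le> x"
    proof (rule ccontr)
      assume "\<not> y \<le> x"
      then have "y - x \<in> ?D"
        using xy by (auto intro!: image_eqI[of _ _ "(x, y)"])
      then have "Min ?D \<le> y - x"
        by (rule Min_le[OF D(1)])
      then show False
        using xy(3) by linarith
    qed
  qed
qed

lemma weight_le_sum:
  assumes "s \<in> binary_vecs (dim_col X)"
  shows "weight X s \<le> (\<Sum>i<dim_col X. (eucl_norm (col X i))\<^sup>2)"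
  unfolding weight_def
  using assms by (intro sum_mono) (auto simp: binary_vecs_def)

theorem proposition11:
  fixes X :: "real mat" and n p a k :: nat
  assumes "X \<in> carrier_mat n p" and "centered X"
    and "0 < a" and "a \<le> n" and "0 < k" and "k \<le> p"
  shows "\<exists>\<delta>\<^sub>0 \<eta>bar :: real. \<delta>\<^sub>0 > 0 \<and> \<eta>bar \<ge> 0 \<and>
    (\<forall>(U :: real vec \<Rightarrow> real mat) (\<delta> :: real) (\<eta>\<^sub>0 :: real) (lam :: nat) (st :: alg2_state)
        (\<theta> :: nat) (s\<theta> :: real vec).
       loading_selection X a U \<and> 0 < \<delta> \<and> \<delta> \<le> \<delta>\<^sub>0 \<and> \<eta>\<^sub>0 \<ge> \<eta>bar \<and>
       alg2_reaches X k U \<eta>\<^sub>0 \<delta> lam st \<and> counter st \<ge> 1 \<and>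
       card (cuts st) = \<theta> \<and> phi_optimal X k (cuts st) s\<theta> \<longrightarrow>
       (if f_best st \<ge> weight X s\<theta>
        then P_optimal X a k (s_best st, U (s_best st))
        else P_value X a k \<le> weight X s\<theta>))"
proof -
  \<comment> \<open>Each residual is at most the weight, and each weight at most this sum; it serves
    as the lower bound on the initial parameter.\<close>
  define B where "B = (\<Sum>i<dim_col X. (eucl_norm (col X i))\<^sup>2)"
  text \<open>Written without \<open>U\<close>, since \<open>\<delta>\<^sub>0\<close> must not depend on it.\<close>
  define R where "R s = weight X s - (SUP V\<in>orthonormal_cols (dim_row X) a. P_objective X a (s, V))"
    for s
  obtain d where d: "0 < d"
    "\<And>s s'. s \<in> binary_vecs (dim_col X) \<Longrightarrow> s' \<in> binary_vecs (dim_col X) \<Longrightarrow>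
      R s' - d < R s \<Longrightarrow> R s' \<le> R s"
    using finite_set_gap[OF finite_imageI[OF finite_binary_vecs], of R "dim_col X"]
    by (metis imageI)
  show ?thesis
  proof (rule exI[of _ d], rule exI[of _ B], intro conjI allI impI)
    show "0 < d" "0 \<le> B"
      by (simp_all add: d B_def sum_nonneg)
    fix U \<delta> \<eta>\<^sub>0 lam st \<theta> s\<theta>
    assume asm: "loading_selection X a U \<and> 0 < \<delta> \<and> \<delta> \<le> d \<and> B \<le> \<eta>\<^sub>0 \<and>
       alg2_reaches X k U \<eta>\<^sub>0 \<delta> lam st \<and> 1 \<le> counter st \<and>
       card (cuts st) = \<theta> \<and> phi_optimal X k (cuts st) s\<theta>"
    then have U: "loading_selection X a U" and \<delta>: "0 < \<delta>" and c: "counter st \<noteq> 0"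
      and opt: "phi_optimal X k (cuts st) s\<theta>"
      by auto
    have R: "resid X U s = R s" if "s \<in> binary_vecs (dim_col X)" for s
      using resid_eq[OF U that] explained_eq_SUP[OF U that] by (simp add: R_def)
    have gap: "resid X U s' \<le> resid X U s"
      if "s \<in> binary_vecs (dim_col X)" "s' \<in> binary_vecs (dim_col X)"
        "resid X U s' - \<delta> < resid X U s" for s s'
      \<comment> \<open>The gap \<open>d\<close> found for \<open>R\<close> remains valid for every
        smaller \<delta>.\<close>
      using d(2)[OF that(1,2)] that(3) asm by (simp add: R that)
    have B: "resid X U s \<le> B" if "s \<in> binary_vecs (dim_col X)" for s
      using resid_eq[OF U that] weight_le_sum[OF that] explained_nonneg[OF U, of s]
      by (simp add: B_def)
    have inv: "alg2_inv X k U B st"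
      using alg2_inv_reaches[OF U \<delta> gap B] asm by blast
    show "if weight X s\<theta> \<le> f_best st
        then P_optimal X a k (s_best st, U (s_best st))
        else P_value X a k \<le> weight X s\<theta>"
      using alg2_inv_optimal[OF U \<delta> gap B inv c opt] alg2_inv_P_value[OF U \<delta> gap B inv c opt]
      by auto
  qed
qed

end
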